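(* Let $T$ be an unbiased estimator of $\theta$ and let $g_1,g_2,\dots$ be a sequence of zero-estimators, i.e. $E_\theta(g_i)=0$ for all $i\in\mathbb{N}$ and all $\theta$. Let $\mathcal{G}=\{\sum_{k=1}^m c_k g_k : c_k\in\mathbb{R},\ m\in\mathbb{N}\}$. Let $\mathbf{g}_m=(g_1,\dots,g_m)^T$ and assume that the covariance matrix $M=\mathrm{Var}[\mathbf{g}_m]$ is positive definite for every $m$. Let $R^*=T+g^*$ with $g^*\in\mathcal{G}$. Then $R^*$ is an optimal oracle estimator (OOE) of $\theta$ with respect to $\mathcal{G}$ if and only if $R^*$ is uncorrelated with every zero-estimator $g\in\mathcal{G}$, i.e. $\mathrm{Cov}_\theta[R^*,g]=0$ for all $g\in\mathcal{G}$ and for all $\theta$.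
   Context: $R^*=T+g^*$ with $g^*\in\mathcal{G}$ is called an optimal oracle estimator (OOE) of $\theta$ with respect to $\mathcal{G}$ if $\mathrm{Var}_\theta[T+g^*]\le \mathrm{Var}_\theta[T+g]$ for all $g\in\mathcal{G}$ and for all $\theta$. The word "oracle" is used because $g^*=\sum_{k=1}^m c_k^* g_k$ for some optimal coefficients $c_1^*,\dots,c_m^*$ which are functions of the unknown parameter $\theta$; the inequality and the uncorrelatedness condition are understood for each $\theta$, with the coefficients of $g^*$ taken at that $\theta$. Subscript $\theta$ on $E$, $\mathrm{Var}$, $\mathrm{Cov}$ means that they are computed under the distribution with parameter $\theta$. *)

theory Defs
  imports "HOL-Probability.Probability" "Jordan_Normal_Form.Matrix"
begin

text \<open>
  A statistical model with a real parameter: a family of probability measures on one common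
  measurable space \<open>S\<close>, so that an estimator is a single measurable function on \<open>S\<close> which does
  not depend on the parameter.
\<close>

definition statistical_model :: "'a measure \<Rightarrow> real set \<Rightarrow> (real \<Rightarrow> 'a measure) \<Rightarrow> bool" where
  "statistical_model S \<Theta> P \<longleftrightarrow> (\<forall>\<theta>\<in>\<Theta>. prob_space (P \<theta>) \<and> sets (P \<theta>) = sets S)"

text \<open>
  The Bochner integral is \<open>0\<close> on non-integrable functions. Requiring a finite second moment at
  every parameter makes all means, variances and covariances below genuine ones.
\<close>

definition finite_variance_estimator ::
    "'a measure \<Rightarrow> real set \<Rightarrow> (real \<Rightarrow> 'a measure) \<Rightarrow> ('a \<Rightarrow> real) \<Rightarrow> bool" where
  "finite_variance_estimator S \<Theta> P X \<longleftrightarrow>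
     X \<in> borel_measurable S \<and> (\<forall>\<theta>\<in>\<Theta>. integrable (P \<theta>) (\<lambda>x. (X x)\<^sup>2))"

definition unbiased_estimator :: "real set \<Rightarrow> (real \<Rightarrow> 'a measure) \<Rightarrow> ('a \<Rightarrow> real) \<Rightarrow> bool" where
  "unbiased_estimator \<Theta> P X \<longleftrightarrow>
     (\<forall>\<theta>\<in>\<Theta>. integrable (P \<theta>) X \<and> prob_space.expectation (P \<theta>) X = \<theta>)"

definition zero_estimator :: "real set \<Rightarrow> (real \<Rightarrow> 'a measure) \<Rightarrow> ('a \<Rightarrow> real) \<Rightarrow> bool" where
  "zero_estimator \<Theta> P X \<longleftrightarrow>
     (\<forall>\<theta>\<in>\<Theta>. integrable (P \<theta>) X \<and> prob_space.expectation (P \<theta>) X = 0)"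

definition covariance :: "'a measure \<Rightarrow> ('a \<Rightarrow> real) \<Rightarrow> ('a \<Rightarrow> real) \<Rightarrow> real" where
  "covariance M X Y =
     prob_space.expectation M
       (\<lambda>x. (X x - prob_space.expectation M X) * (Y x - prob_space.expectation M Y))"

text \<open>
  Sequences of estimators are indexed from \<open>1\<close>, matrices from \<open>0\<close>: the entry \<open>(i, j)\<close> is the
  covariance of \<open>g (i + 1)\<close> and \<open>g (j + 1)\<close>.
\<close>

definition covariance_matrix :: "'a measure \<Rightarrow> (nat \<Rightarrow> 'a \<Rightarrow> real) \<Rightarrow> nat \<Rightarrow> real mat" where
  "covariance_matrix M g m = mat m m (\<lambda>(i, j). covariance M (g (Suc i)) (g (Suc j)))"

definition positive_definite :: "real mat \<Rightarrow> bool" where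
  "positive_definite A \<longleftrightarrow>
     transpose_mat A = A \<and>
     (\<forall>v \<in> carrier_vec (dim_row A). v \<noteq> 0\<^sub>v (dim_row A) \<longrightarrow> scalar_prod v (A *\<^sub>v v) > 0)"

definition linear_combinations :: "(nat \<Rightarrow> 'a \<Rightarrow> real) \<Rightarrow> ('a \<Rightarrow> real) set" where
  "linear_combinations g = {\<lambda>x. \<Sum>k=1..m. c k * g k x | (m :: nat) (c :: nat \<Rightarrow> real). True}"

text \<open>
  Oracle combinations: the coefficients may be functions of the unknown parameter. Their value
  at each parameter is an element of \<^term>\<open>linear_combinations g\<close>.
\<close>

definition oracle_combinations :: "(nat \<Rightarrow> 'a \<Rightarrow> real) \<Rightarrow> (real \<Rightarrow> 'a \<Rightarrow> real) set" where
  "oracle_combinations g =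
     {\<lambda>\<theta> x. \<Sum>k=1..m. c k \<theta> * g k x | (m :: nat) (c :: nat \<Rightarrow> real \<Rightarrow> real). True}"

definition optimal_oracle_estimator ::
    "real set \<Rightarrow> (real \<Rightarrow> 'a measure) \<Rightarrow> ('a \<Rightarrow> real) \<Rightarrow> (nat \<Rightarrow> 'a \<Rightarrow> real) \<Rightarrow>
     (real \<Rightarrow> 'a \<Rightarrow> real) \<Rightarrow> bool" where
  "optimal_oracle_estimator \<Theta> P T g R \<longleftrightarrow>
     (\<exists>gstar \<in> oracle_combinations g. R = (\<lambda>\<theta> x. T x + gstar \<theta> x)) \<and>
     (\<forall>h \<in> linear_combinations g. \<forall>\<theta>\<in>\<Theta>.
        prob_space.variance (P \<theta>) (R \<theta>) \<le> prob_space.variance (P \<theta>) (\<lambda>x. T x + h x))"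

end

theory Submission
  imports Defs
begin

text \<open>
  Fix the parameter. For \<open>h\<close> in the linear span of the zero-estimators,
  \<open>Var (R + t h) = Var R + 2 t Cov (R, h) + t\<^sup>2 Var h\<close> for every real \<open>t\<close>. If \<open>R\<close> has minimal
  variance, this quadratic in \<open>t\<close> is minimal at \<open>t = 0\<close>, so its linear coefficient vanishes.
  Conversely, \<open>T + h = R + (h - g\<^sup>*)\<close> with \<open>h - g\<^sup>*\<close> in the span, and the cross term vanishes.
\<close>

lemma (in prob_space) integrable_mult_square_integrable:
  fixes X Y :: "'a \<Rightarrow> real"
  assumes [measurable]: "X \<in> borel_measurable M" "Y \<in> borel_measurable M"
    and X: "integrable M (\<lambda>x. (X x)\<^sup>2)" and Y: "integrable M (\<lambda>x. (Y x)\<^sup>2)"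
  shows "integrable M (\<lambda>x. X x * Y x)"
proof (rule Bochner_Integration.integrable_bound)
  show "integrable M (\<lambda>x. (X x)\<^sup>2 + (Y x)\<^sup>2)"
    using X Y by simp
  have "\<bar>a * b\<bar> \<le> a\<^sup>2 + b\<^sup>2" for a b :: real
    using sum_squares_bound[of "\<bar>a\<bar>" "\<bar>b\<bar>"] mult_nonneg_nonneg[OF abs_ge_zero[of a] abs_ge_zero[of b]]
    unfolding abs_mult power2_abs by linarith
  then show "AE x in M. norm (X x * Y x) \<le> norm ((X x)\<^sup>2 + (Y x)\<^sup>2)"
    by simp
qed measurable

text \<open>The factor \<open>t\<close> allows two uses: appending one summand to a linear
  combination, with \<open>t\<close> its coefficient, and forming \<open>T + g*\<close>, with
  \<open>t = 1\<close>.\<close>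

lemma (in prob_space) integrable_square_add_mult:
  fixes X Y :: "'a \<Rightarrow> real"
  assumes "X \<in> borel_measurable M" "Y \<in> borel_measurable M"
    and "integrable M (\<lambda>x. (X x)\<^sup>2)" "integrable M (\<lambda>x. (Y x)\<^sup>2)"
  shows "integrable M (\<lambda>x. (X x + t * Y x)\<^sup>2)"
proof -
  have "(\<lambda>x. (X x + t * Y x)\<^sup>2) = (\<lambda>x. (X x)\<^sup>2 + 2 * t * (X x * Y x) + t\<^sup>2 * (Y x)\<^sup>2)"
    by (auto simp: power2_eq_square algebra_simps)
  then show ?thesis
    using assms integrable_mult_square_integrable[OF assms] by simp
qed

lemma (in prob_space) variance_add_mult:
  fixes X Y :: "'a \<Rightarrow> real"
  assumes X [measurable]: "X \<in> borel_measurable M" and Y [measurable]: "Y \<in> borel_measurable M"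
    and X2: "integrable M (\<lambda>x. (X x)\<^sup>2)" and Y2: "integrable M (\<lambda>x. (Y x)\<^sup>2)"
  shows "variance (\<lambda>x. X x + t * Y x) = variance X + 2 * t * covariance M X Y + t\<^sup>2 * variance Y"
proof -
  let ?X = "\<lambda>x. X x - expectation X" and ?Y = "\<lambda>x. Y x - expectation Y"
  have [simp]: "integrable M X" "integrable M Y"
    using square_integrable_imp_integrable X Y X2 Y2 by blast+
  have X2': "integrable M (\<lambda>x. (?X x)\<^sup>2)" and Y2': "integrable M (\<lambda>x. (?Y x)\<^sup>2)"
    using X2 Y2 by (simp_all add: power2_diff)
  have XY: "integrable M (\<lambda>x. ?X x * ?Y x)"
    using X2' Y2' by (intro integrable_mult_square_integrable) auto
  \<comment> \<open>Since \<open>X\<close> and \<open>Y\<close> are integrable, expectation is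
    linear on them, so centring \<open>X + t * Y\<close> yields \<open>?X + t * ?Y\<close>, whose
    square is expanded pointwise.\<close>
  have "variance (\<lambda>x. X x + t * Y x) =
      expectation (\<lambda>x. (?X x)\<^sup>2 + 2 * t * (?X x * ?Y x) + t\<^sup>2 * (?Y x)\<^sup>2)"
    by (intro Bochner_Integration.integral_cong)
      (auto simp: power2_eq_square algebra_simps)
  also have "\<dots> = variance X + 2 * t * covariance M X Y + t\<^sup>2 * variance Y"
    unfolding covariance_def using X2' Y2' XY by simp
  finally show ?thesis .
qed

lemma quadratic_nonneg_linear_coeff_zero:
  fixes c v :: real
  assumes "v \<ge> 0" and nonneg: "\<And>t. 0 \<le> 2 * t * c + t\<^sup>2 * v"
  shows "c = 0"
proof (rule ccontr)
  assume "c \<noteq> 0"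
  \<comment> \<open>For \<open>v > 0\<close> the minimiser of the quadratic is
    \<open>- c / v\<close>. Replacing \<open>v\<close> by \<open>v + 1\<close> avoids a division by
    zero when \<open>v = 0\<close> and still gives a negative value.\<close>
  have "2 * (- c / (v + 1)) * c + (- c / (v + 1))\<^sup>2 * v = - (c\<^sup>2 * (v + 2)) / (v + 1)\<^sup>2"
    using \<open>v \<ge> 0\<close> by (simp add: power2_eq_square divide_simps) (simp add: algebra_simps)
  also have "\<dots> < 0"
    using \<open>v \<ge> 0\<close> \<open>c \<noteq> 0\<close> by (simp add: divide_neg_pos)
  finally show False
    using nonneg[of "- c / (v + 1)"] by simp
qed

lemma (in prob_space) covariance_zero_if_variance_minimal:
  fixes X Y :: "'a \<Rightarrow> real"
  assumes "X \<in> borel_measurable M" "Y \<in> borel_measurable M"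
    and "integrable M (\<lambda>x. (X x)\<^sup>2)" "integrable M (\<lambda>x. (Y x)\<^sup>2)"
    and "\<And>t. variance X \<le> variance (\<lambda>x. X x + t * Y x)"
  shows "covariance M X Y = 0"
proof (rule quadratic_nonneg_linear_coeff_zero)
  show "variance Y \<ge> 0"
    by (rule variance_positive)
  show "0 \<le> 2 * t * covariance M X Y + t\<^sup>2 * variance Y" for t
    using assms(5)[of t] variance_add_mult[OF assms(1-4), of t] by linarith
qed

text \<open>Supplies both perturbations of the main proof: \<open>g* + t * h\<close> with arbitrary
  \<open>t\<close>, and \<open>h - g*\<close> with \<open>t = - 1\<close>.\<close>

lemma linear_combinations_add_mult:
  assumes "h \<in> linear_combinations g" and "k \<in> linear_combinations g"
  shows "(\<lambda>x. h x + t * k x) \<in> linear_combinations g"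
proof -
  obtain m c where h: "h = (\<lambda>x. \<Sum>i=1..m. c i * g i x)"
    using assms(1) unfolding linear_combinations_def by blast
  obtain n d where k: "k = (\<lambda>x. \<Sum>i=1..n. d i * g i x)"
    using assms(2) unfolding linear_combinations_def by blast
  \<comment> \<open>The two combinations may have different lengths; zero coefficients extend both
    to length \<open>max m n\<close>, so that they can be added termwise.\<close>
  have pad: "(\<Sum>i=1..p. e i * g i x) = (\<Sum>i=1..max m n. (if i \<le> p then e i else 0) * g i x)"
    if "p \<le> max m n" for p and e :: "nat \<Rightarrow> real" and x
    using that by (intro sum.mono_neutral_cong_left) auto
  let ?e = "\<lambda>i. (if i \<le> m then c i else 0) + t * (if i \<le> n then d i else 0)"
  have "(\<lambda>x. h x + t * k x) = (\<lambda>x. \<Sum>i=1..max m n. ?e i * g i x)"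
    unfolding h k pad[OF max.cobounded1] pad[OF max.cobounded2]
    by (simp only: sum.distrib sum_distrib_left distrib_right mult.assoc)
  then show ?thesis
    unfolding linear_combinations_def
    by (intro CollectI exI[of _ "max m n"] exI[of _ ?e] conjI TrueI)
qed

text \<open>Freezing the parameter turns the coefficient functions into constants. This is what
  allows oracle combinations to be treated, one parameter at a time, as elements of the
  span.\<close>

lemma oracle_combinations_at:
  assumes "h \<in> oracle_combinations g"
  shows "h \<theta> \<in> linear_combinations g"
proof -
  obtain m c where "h = (\<lambda>\<theta> x. \<Sum>k=1..m. c k \<theta> * g k x)"
    using assms unfolding oracle_combinations_def by blast
  then have "h \<theta> = (\<lambda>x. \<Sum>k=1..m. c k \<theta> * g k x)"
    by simp
  then show ?thesis
    unfolding linear_combinations_def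
    by (intro CollectI exI[of _ m] exI[of _ "\<lambda>k. c k \<theta>"] conjI TrueI)
qed

lemma (in prob_space) linear_combinations_square_integrable:
  assumes meas: "\<And>i. i \<ge> 1 \<Longrightarrow> g i \<in> borel_measurable M"
    and sq: "\<And>i. i \<ge> 1 \<Longrightarrow> integrable M (\<lambda>x. (g i x)\<^sup>2)"
    and "h \<in> linear_combinations g"
  shows "h \<in> borel_measurable M" and "integrable M (\<lambda>x. (h x)\<^sup>2)"
proof -
  obtain m c where h: "h = (\<lambda>x. \<Sum>i=1..m. c i * g i x)"
    using assms(3) unfolding linear_combinations_def by blast
  \<comment> \<open>Stated for every length, because the induction below needs measurability of all
    partial sums.\<close>
  have meas_sum: "(\<lambda>x. \<Sum>i=1..m. c i * g i x) \<in> borel_measurable M" for m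
    using meas by (intro borel_measurable_sum borel_measurable_times) auto
  then show "h \<in> borel_measurable M"
    unfolding h .
  have "integrable M (\<lambda>x. (\<Sum>i=1..m. c i * g i x)\<^sup>2)" for m
  proof (induction m)
    case (Suc m)
    have "integrable M (\<lambda>x. ((\<Sum>i=1..m. c i * g i x) + c (Suc m) * g (Suc m) x)\<^sup>2)"
      using meas_sum meas Suc.IH sq by (intro integrable_square_add_mult) auto
    then show ?case
      by simp
  qed simp
  then show "integrable M (\<lambda>x. (h x)\<^sup>2)"
    unfolding h .
qed

theorem theorem1:
  fixes S :: "'a measure" and \<Theta> :: "real set" and P :: "real \<Rightarrow> 'a measure"
    and T :: "'a \<Rightarrow> real" and g :: "nat \<Rightarrow> 'a \<Rightarrow> real"
    and gstar R :: "real \<Rightarrow> 'a \<Rightarrow> real"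
  assumes "statistical_model S \<Theta> P"
    and "finite_variance_estimator S \<Theta> P T"
    and "unbiased_estimator \<Theta> P T"
    and "\<And>i. i \<ge> 1 \<Longrightarrow> finite_variance_estimator S \<Theta> P (g i)"
    and "\<And>i. i \<ge> 1 \<Longrightarrow> zero_estimator \<Theta> P (g i)"
    and "\<And>\<theta> m. \<theta> \<in> \<Theta> \<Longrightarrow> m \<ge> 1 \<Longrightarrow> positive_definite (covariance_matrix (P \<theta>) g m)"
    and "gstar \<in> oracle_combinations g"
    and "R = (\<lambda>\<theta> x. T x + gstar \<theta> x)"
  shows "optimal_oracle_estimator \<Theta> P T g R \<longleftrightarrow>
    (\<forall>h \<in> linear_combinations g. \<forall>\<theta>\<in>\<Theta>. covariance (P \<theta>) (R \<theta>) h = 0)"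
proof -
  have gstar: "gstar \<theta> \<in> linear_combinations g" for \<theta>
    using assms(7) by (rule oracle_combinations_at)
  have prob: "prob_space (P \<theta>)" and sets: "sets (P \<theta>) = sets S" if "\<theta> \<in> \<Theta>" for \<theta>
    using assms(1) that unfolding statistical_model_def by auto
  \<comment> \<open>Measurability is given with respect to \<open>S\<close> and carries over to each
    \<open>P \<theta>\<close>, which has the same measurable sets.\<close>
  have fv: "X \<in> borel_measurable (P \<theta>)" "integrable (P \<theta>) (\<lambda>x. (X x)\<^sup>2)"
    if "\<theta> \<in> \<Theta>" "finite_variance_estimator S \<Theta> P X" for \<theta> X
    using that measurable_cong_sets[OF sets[OF that(1)] refl, of borel]
    unfolding finite_variance_estimator_def by auto
  have lc: "h \<in> borel_measurable (P \<theta>)" "integrable (P \<theta>) (\<lambda>x. (h x)\<^sup>2)"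
    if "\<theta> \<in> \<Theta>" "h \<in> linear_combinations g" for \<theta> h
    using prob_space.linear_combinations_square_integrable[OF prob[OF that(1)] _ _ that(2)]
      fv[OF that(1) assms(4)] by auto
  have R: "R \<theta> \<in> borel_measurable (P \<theta>)" "integrable (P \<theta>) (\<lambda>x. (R \<theta> x)\<^sup>2)"
    if "\<theta> \<in> \<Theta>" for \<theta>
    using fv[OF that assms(2)] lc[OF that gstar]
      prob_space.integrable_square_add_mult[OF prob[OF that], of T "gstar \<theta>" 1]
    unfolding assms(8) by auto
  show ?thesis
  proof
    assume opt: "optimal_oracle_estimator \<Theta> P T g R"
    show "\<forall>h\<in>linear_combinations g. \<forall>\<theta>\<in>\<Theta>. covariance (P \<theta>) (R \<theta>) h = 0"
    proof (intro ballI)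
      fix h \<theta> assume h: "h \<in> linear_combinations g" and \<theta>: "\<theta> \<in> \<Theta>"
      interpret prob_space "P \<theta>" using \<theta> by (rule prob)
      show "covariance (P \<theta>) (R \<theta>) h = 0"
      proof (rule covariance_zero_if_variance_minimal[OF R(1) lc(1) R(2) lc(2)])
        fix t
        \<comment> \<open>The competitor \<open>gstar \<theta> + t * h\<close> has its coefficients
          frozen at the current \<open>\<theta>\<close>, so it is a legitimate element of the span.
          It changes with \<open>\<theta>\<close>, but its inequality is used only at this same
          \<open>\<theta>\<close>.\<close>
        have "variance (R \<theta>) \<le> variance (\<lambda>x. T x + (gstar \<theta> x + t * h x))"
          using opt[unfolded optimal_oracle_estimator_def, THEN conjunct2, rule_format,
              OF linear_combinations_add_mult[OF gstar h] \<theta>] .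
        then show "variance (R \<theta>) \<le> variance (\<lambda>x. R \<theta> x + t * h x)"
          by (simp add: assms(8) add.assoc)
      qed (use h \<theta> in auto)
    qed
  next
    assume uncorr: "\<forall>h\<in>linear_combinations g. \<forall>\<theta>\<in>\<Theta>. covariance (P \<theta>) (R \<theta>) h = 0"
    have "prob_space.variance (P \<theta>) (R \<theta>) \<le> prob_space.variance (P \<theta>) (\<lambda>x. T x + h x)"
      if h: "h \<in> linear_combinations g" and \<theta>: "\<theta> \<in> \<Theta>" for h \<theta>
    proof -
      interpret prob_space "P \<theta>" using \<theta> by (rule prob)
      \<comment> \<open>The difference \<open>h - gstar \<theta>\<close>, chosen so that
        \<open>T + h = R \<theta> + k\<close>; the explicit \<open>- 1\<close> matches the form of
        the closure lemma.\<close>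
      define k where "k = (\<lambda>x. h x + (- 1) * gstar \<theta> x)"
      have k: "k \<in> linear_combinations g"
        unfolding k_def by (rule linear_combinations_add_mult[OF h gstar])
      have "variance (\<lambda>x. T x + h x) = variance (\<lambda>x. R \<theta> x + 1 * k x)"
        by (simp add: k_def assms(8))
      also have "\<dots> = variance (R \<theta>) + variance k"
        using variance_add_mult[OF R(1) lc(1) R(2) lc(2), OF \<theta> \<theta> k \<theta> \<theta> k, of 1] uncorr k \<theta>
        by simp
      finally show ?thesis
        using variance_positive[of k] by linarith
    qed
    then show "optimal_oracle_estimator \<Theta> P T g R"
      unfolding optimal_oracle_estimator_def using assms(7,8) by blast
  qed
qed

end
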